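(* Consider the multi-objective saturation problem described in the context, for either of the two controller classes (static state feedback or full-order dynamic output feedback). Let $\gamma_{con}^*$ and $\gamma_{new}^*$ be the optimal values (infima, with $\inf\emptyset=+\infty$) of Algorithm 1 and Algorithm 2, respectively, as defined in the context. Then Algorithm 2, with a common auxiliary variable $G$ but with non-common Lyapunov variables, always achieves an upper bound estimate for the $L_2$ gain that is less than or equal to the $L_2$ gain estimate achieved by Algorithm 1: $$\gamma_{new}^*\le\gamma_{con}^*.$$
   Context: Notation: $\mathbf{He}(A)=A+A^T$; $\star$ denotes entries determined by symmetry; for symmetric matrices $M>0$ ($M<0$) means positive (negative) definite. Plant: $\dot x_p=Ax_p+B_1w+B_2u$, $z=C_1x_p+D_{11}w+D_{12}u$, $y=C_2x_p+D_{21}w$, with peak-bounded disturbance $w(t)^Tw(t)\le w_{max}^2$ and actuator limit $u_{lim}$ ($w_{max},u_{lim}>0$). The controller is either static state feedback $u=K_0x_p$ (closed-loop state $x=x_p$, and $K=K_0$), or a dynamic output feedback $\dot x_c=A_cx_c+B_cy$, $u=C_cx_c$ with $A_c$ of the same order as $A$ (closed-loop state $x=[x_p^T\ x_c^T]^T$, and $K=[0\ \ C_c]$). In either case the closed loop is $\dot x=A_{cl}x+B_{cl}w$, $z=C_{cl}x+D_{cl}w$, $u=Kx$, where $(A_{cl},B_{cl},C_{cl},D_{cl},K)$ is determined by the controller. Problem: choose a controller in the given class making the closed loop internally stable, never violating the saturation limit $u_{lim}$, with smallest guaranteed $L_2$ gain bound from $w$ to $z$. Algorithm 1 (conventional): minimize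 $\gamma_{con}$ over controllers in the class, symmetric matrices $Q>0$ and scalars $\alpha_{con}>0$ subject to $$\left(\begin{array}{ccc} A_{cl}Q+QA_{cl}^T & B_{cl} & QC_{cl}^T\\ \star & -\gamma_{con}I & D_{cl}^T\\ \star&\star&-\gamma_{con}I\end{array}\right)<0,\quad \left(\begin{array}{cc} A_{cl}Q+QA_{cl}^T+\alpha_{con}Q & B_{cl}\\ \star & -\alpha_{con}I\end{array}\right)<0,\quad \left(\begin{array}{cc} -Q & -QK^T\\ \star & -\frac{u_{lim}^2}{w_{max}^2}I\end{array}\right)<0.$$ Algorithm 2 (new): minimize $\gamma_{new}$ over controllers in the class, symmetric matrices $X_1>0$, $X_2>0$, a square matrix $G$ (not necessarily symmetric), scalars $\alpha_{new}>0$ and $\epsilon_1,\epsilon_2,\epsilon_3\in(0,1)$ subject to $$\left(\begin{array}{cccc} X_1 & B_{cl} & 0 & -X_1\\ \star & -\gamma_{new}I & D_{cl}^T & 0\\ \star&\star&-\gamma_{new}I&0\\ \star&\star&\star&0\end{array}\right)+\mathbf{He}(\mathcal{Q}_1^TG\mathcal{P}_1)<0,$$ $$\left(\begin{array}{ccc} X_2 & B_{cl} & -X_2\\ \star & -\alpha_{new}I & 0\\ \star&\star&0\end{array}\right)+\mathbf{He}(\mathcal{Q}_2^TG\mathcal{P}_2)<0,\qquad \left(\begin{array}{ccc} X_2 & 0 & -X_2\\ \star & -\frac{u_{lim}^2}{w_{max}^2}I & 0\\ \star&\star&0\end{array}\right)+\mathbf{He}(\mathcal{Q}_3^TG\mathcal{P}_3)<0,$$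 where $\mathcal{P}_1=[I\ \ 0\ \ 0\ \ -2\epsilon_1I]$, $\mathcal{Q}_1=[(A_{cl}^T-\frac12I)\ \ 0\ \ C_{cl}^T\ \ I]$; $\mathcal{P}_2=[I\ \ 0\ \ -2\epsilon_2I]$, $\mathcal{Q}_2=[(A_{cl}^T+\frac{\alpha_{new}}{2}I-\frac12I)\ \ 0\ \ I]$; $\mathcal{P}_3=[I\ \ 0\ \ -2\epsilon_3I]$, $\mathcal{Q}_3=[-I\ \ -K^T\ \ I]$, all partitioned conformally. The values $\gamma_{con}$ and $\gamma_{new}$ are the respective upper bound estimates of the closed-loop $L_2$ gain. *)

theory Defs
  imports "HOL-Analysis.Analysis"
begin

section \<open>Block matrices and definiteness\<close>

text \<open>Blocks are indexed by sum types; both operators associate to the right, so an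
  \<open>a + b + c\<close> partition is written \<open>X ||| Y ||| Z\<close> (columns) and \<open>X /// Y /// Z\<close> (rows).\<close>

definition hcat :: "real^'a^'m \<Rightarrow> real^'b^'m \<Rightarrow> real^('a + 'b)^'m" (infixr "|||" 56)
  where "X ||| Y = (\<chi> i j. case j of Inl a \<Rightarrow> X $ i $ a | Inr b \<Rightarrow> Y $ i $ b)"

definition vcat :: "('c^'a) \<Rightarrow> ('c^'b) \<Rightarrow> 'c^('a + 'b)" (infixr "'/'/'/" 53)
  where "X /// Y = (\<chi> i. case i of Inl a \<Rightarrow> X $ a | Inr b \<Rightarrow> Y $ b)"

definition He :: "real^'n^'n \<Rightarrow> real^'n^'n"
  where "He M = M + transpose M"

definition pos_def :: "real^'n^'n \<Rightarrow> bool"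
  where "pos_def M \<longleftrightarrow> transpose M = M \<and> (\<forall>x. x \<noteq> 0 \<longrightarrow> x \<bullet> (M *v x) > 0)"

definition neg_def :: "real^'n^'n \<Rightarrow> bool"
  where "neg_def M \<longleftrightarrow> transpose M = M \<and> (\<forall>x. x \<noteq> 0 \<longrightarrow> x \<bullet> (M *v x) < 0)"


section \<open>Plant, controllers and closed loop\<close>

text \<open>Dimensions are index types: \<open>'n\<close> for the plant state, \<open>'w\<close> for the disturbance, \<open>'u\<close> for
  the control input, \<open>'z\<close> for the performance output, \<open>'y\<close> for the measurement, \<open>'s\<close> for the
  closed-loop state.\<close>

record ('n::finite, 'w::finite, 'u::finite, 'z::finite, 'y::finite) plant =
  pl_A   :: "real^'n^'n"
  pl_B1  :: "real^'w^'n"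
  pl_B2  :: "real^'u^'n"
  pl_C1  :: "real^'n^'z"
  pl_D11 :: "real^'w^'z"
  pl_D12 :: "real^'u^'z"
  pl_C2  :: "real^'n^'y"
  pl_D21 :: "real^'w^'y"

record ('s::finite, 'w::finite, 'u::finite, 'z::finite) closed_loop =
  Acl :: "real^'s^'s"
  Bcl :: "real^'w^'s"
  Ccl :: "real^'s^'z"
  Dcl :: "real^'w^'z"
  Kcl :: "real^'s^'u"

record ('n::finite, 'u::finite, 'y::finite) dyn_controller =
  ctl_A :: "real^'n^'n"
  ctl_B :: "real^'y^'n"
  ctl_C :: "real^'n^'u"

definition state_feedback_loop ::
  "('n::finite, 'w::finite, 'u::finite, 'z::finite, 'y::finite) plant \<Rightarrow> real^'n^'u \<Rightarrow> ('n, 'w, 'u, 'z) closed_loop"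
  where "state_feedback_loop P K0 =
    \<lparr> Acl = pl_A P + pl_B2 P ** K0,
      Bcl = pl_B1 P,
      Ccl = pl_C1 P + pl_D12 P ** K0,
      Dcl = pl_D11 P,
      Kcl = K0 \<rparr>"

definition output_feedback_loop ::
  "('n::finite, 'w::finite, 'u::finite, 'z::finite, 'y::finite) plant \<Rightarrow> ('n, 'u, 'y) dyn_controller
    \<Rightarrow> ('n + 'n, 'w, 'u, 'z) closed_loop"
  where "output_feedback_loop P c =
    \<lparr> Acl = (pl_A P             ||| pl_B2 P ** ctl_C c)
        /// (ctl_B c ** pl_C2 P ||| ctl_A c),
      Bcl = pl_B1 P
        /// ctl_B c ** pl_D21 P,
      Ccl = pl_C1 P ||| pl_D12 P ** ctl_C c,
      Dcl = pl_D11 P,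
      Kcl = 0 ||| ctl_C c \<rparr>"

text \<open>The two realizations do result from closing the loop around the plant.\<close>

lemma state_feedback_loop_eqs:
  fixes P :: "('n::finite, 'w::finite, 'u::finite, 'z::finite, 'y::finite) plant"
  assumes "u = K0 *v x"
  defines "L \<equiv> state_feedback_loop P K0"
  shows "pl_A P *v x + pl_B1 P *v w + pl_B2 P *v u = Acl L *v x + Bcl L *v w"
    and "pl_C1 P *v x + pl_D11 P *v w + pl_D12 P *v u = Ccl L *v x + Dcl L *v w"
    and "u = Kcl L *v x"
  using assms
  by (simp_all add: state_feedback_loop_def matrix_vector_mult_add_rdistrib
      matrix_vector_mul_assoc)

lemma hcat_mult_vec: "(X ||| Y) *v (x /// y) = X *v x + Y *v y"
  by (simp add: hcat_def vcat_def matrix_vector_mult_def vec_eq_iff UNIV_Plus_UNIV[symmetric]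
      sum.Plus del: UNIV_Plus_UNIV)

lemma vcat_mult_vec: "(X /// Y) *v x = (X *v x) /// (Y *v x)" for X :: "real^'a^'b"
  by (simp add: vcat_def matrix_vector_mult_def vec_eq_iff split: sum.split)

lemma vcat_add: "(x /// y) + (x' /// y') = (x + x') /// (y + y')" for x :: "real^'a"
  by (simp add: vcat_def vec_eq_iff split: sum.split)

lemma output_feedback_loop_eqs:
  fixes P :: "('n::finite, 'w::finite, 'u::finite, 'z::finite, 'y::finite) plant"
    and c :: "('n, 'u, 'y) dyn_controller"
  assumes "y = pl_C2 P *v xp + pl_D21 P *v w" and "u = ctl_C c *v xc"
  defines "L \<equiv> output_feedback_loop P c" and "x \<equiv> xp /// xc"
  shows "(pl_A P *v xp + pl_B1 P *v w + pl_B2 P *v u) /// (ctl_A c *v xc + ctl_B c *v y)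
           = Acl L *v x + Bcl L *v w"
    and "pl_C1 P *v xp + pl_D11 P *v w + pl_D12 P *v u = Ccl L *v x + Dcl L *v w"
    and "u = Kcl L *v x"
  using assms
  by (simp_all add: output_feedback_loop_def hcat_mult_vec vcat_mult_vec vcat_add
      matrix_vector_right_distrib matrix_vector_mul_assoc add_ac)


section \<open>The two synthesis algorithms\<close>

definition feasible_con ::
  "real \<Rightarrow> real \<Rightarrow> ('s::finite, 'w::finite, 'u::finite, 'z::finite) closed_loop \<Rightarrow> real \<Rightarrow> real^'s^'s \<Rightarrow> real \<Rightarrow> bool"
  where "feasible_con ulim wmax L \<gamma> Q \<alpha> \<longleftrightarrow>
    pos_def Q \<and> \<alpha> > 0 \<and>
    neg_def
      (   (Acl L ** Q + Q ** transpose (Acl L) ||| Bcl L   ||| Q ** transpose (Ccl L))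
      /// (transpose (Bcl L)                   ||| - mat \<gamma> ||| transpose (Dcl L))
      /// (Ccl L ** Q                          ||| Dcl L   ||| - mat \<gamma>)) \<and>
    neg_def
      (   (Acl L ** Q + Q ** transpose (Acl L) + \<alpha> *\<^sub>R Q ||| Bcl L)
      /// (transpose (Bcl L)                            ||| - mat \<alpha>)) \<and>
    neg_def
      (   (- Q              ||| - (Q ** transpose (Kcl L)))
      /// (- (Kcl L ** Q)   ||| - mat (ulim\<^sup>2 / wmax\<^sup>2)))"

definition feasible_new ::
  "real \<Rightarrow> real \<Rightarrow> ('s::finite, 'w::finite, 'u::finite, 'z::finite) closed_loop \<Rightarrow> real \<Rightarrow> real^'s^'s \<Rightarrow> real^'s^'s \<Rightarrow> real^'s^'s
    \<Rightarrow> real \<Rightarrow> real \<Rightarrow> real \<Rightarrow> real \<Rightarrow> bool"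
  where "feasible_new ulim wmax L \<gamma> X1 X2 G \<alpha> \<epsilon>1 \<epsilon>2 \<epsilon>3 \<longleftrightarrow>
    pos_def X1 \<and> pos_def X2 \<and> \<alpha> > 0 \<and>
    \<epsilon>1 \<in> {0<..<1} \<and> \<epsilon>2 \<in> {0<..<1} \<and> \<epsilon>3 \<in> {0<..<1} \<and>
    neg_def
      ((  (X1                ||| Bcl L   ||| 0                 ||| - X1)
      /// (transpose (Bcl L) ||| - mat \<gamma> ||| transpose (Dcl L) ||| 0)
      /// (0                 ||| Dcl L   ||| - mat \<gamma>           ||| 0)
      /// (- X1              ||| 0       ||| 0                 ||| 0))
      + He (transpose (transpose (Acl L) - mat (1/2) ||| 0 ||| transpose (Ccl L) ||| mat 1)
            ** G ** (mat 1 ||| 0 ||| 0 ||| - mat (2 * \<epsilon>1)))) \<and>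
    neg_def
      ((  (X2                ||| Bcl L   ||| - X2)
      /// (transpose (Bcl L) ||| - mat \<alpha> ||| 0)
      /// (- X2              ||| 0       ||| 0))
      + He (transpose (transpose (Acl L) + mat (\<alpha>/2) - mat (1/2) ||| 0 ||| mat 1)
            ** G ** (mat 1 ||| 0 ||| - mat (2 * \<epsilon>2)))) \<and>
    neg_def
      ((  (X2   ||| 0                       ||| - X2)
      /// (0    ||| - mat (ulim\<^sup>2 / wmax\<^sup>2) ||| 0)
      /// (- X2 ||| 0                       ||| 0))
      + He (transpose (- mat 1 ||| - transpose (Kcl L) ||| mat 1)
            ** G ** (mat 1 ||| 0 ||| - mat (2 * \<epsilon>3))))"

text \<open>The optimal values are taken over all controllers of a class, given by the map
  \<open>loop\<close> from controllers to closed loops; in \<open>ereal\<close>, \<open>Inf {} = \<infinity>\<close>.\<close>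

definition gamma_con :: "real \<Rightarrow> real \<Rightarrow> ('k \<Rightarrow> ('s::finite, 'w::finite, 'u::finite, 'z::finite) closed_loop) \<Rightarrow> ereal"
  where "gamma_con ulim wmax loop =
    Inf {ereal \<gamma> | \<gamma>. \<exists>c Q \<alpha>. feasible_con ulim wmax (loop c) \<gamma> Q \<alpha>}"

definition gamma_new :: "real \<Rightarrow> real \<Rightarrow> ('k \<Rightarrow> ('s::finite, 'w::finite, 'u::finite, 'z::finite) closed_loop) \<Rightarrow> ereal"
  where "gamma_new ulim wmax loop =
    Inf {ereal \<gamma> | \<gamma>. \<exists>c X1 X2 G \<alpha> \<epsilon>1 \<epsilon>2 \<epsilon>3.
      feasible_new ulim wmax (loop c) \<gamma> X1 X2 G \<alpha> \<epsilon>1 \<epsilon>2 \<epsilon>3}"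

end

theory Submission
  imports Defs
begin

text \<open>
  Fix a controller and let \<open>(\<gamma>, Q, \<alpha>)\<close> be feasible for the conventional algorithm. The new
  algorithm is then feasible for the same controller, with the same \<open>\<gamma>\<close> and \<open>\<alpha>\<close>: take both
  Lyapunov variables and the auxiliary variable equal to \<open>Q\<close>. With this choice each new
  inequality is a dilation of its conventional counterpart. Split the vector into a last block
  \<open>v\<close> and a head \<open>h\<close> consisting of the other blocks, the first of which is \<open>x\<close>. The term
  \<open>- 2 (x \<bullet> Q v)\<close> from the Lyapunov variable cancels \<open>2 (v \<bullet> Q x)\<close> from the auxiliary variable,
  and the quadratic form becomes \<open>h \<bullet> M h - 4 \<epsilon> (h \<bullet> N v + v \<bullet> Q v)\<close>, where \<open>M\<close> is the
  conventional matrix and \<open>N\<close> does not depend on \<open>\<epsilon>\<close>.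

  Since \<open>M\<close> is negative and \<open>Q\<close> positive definite, this form is negative definite for small
  \<open>\<epsilon> > 0\<close>: completing the square, the cross term costs only order \<open>\<epsilon>\<^sup>2\<close> in \<open>v\<close>, against the
  gain \<open>4 \<epsilon> (v \<bullet> Q v)\<close> (\<open>small_dilation_negative\<close>). The three inequalities have separate
  parameters, so each can be taken as small as its own inequality requires
  (\<open>feasible_con_imp_feasible_new\<close>).

  So for every controller the values \<open>\<gamma>\<close> attainable conventionally remain attainable, and the
  infimum over all controllers can only drop, whatever the controller class.
\<close>

section \<open>Block vectors and quadratic forms\<close>

lemma inner_vcat: "(x /// y) \<bullet> (x' /// y') = x \<bullet> x' + y \<bullet> y'"
  for x x' :: "real^'a::finite" and y y' :: "real^'b::finite"
  by (simp add: inner_vec_def vcat_def UNIV_Plus_UNIV[symmetric] sum.Plus del: UNIV_Plus_UNIV)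

lemma vcat_exhaust:
  obtains x y where "v = x /// y"
proof
  show "v = (\<chi> i. v $ Inl i) /// (\<chi> i. v $ Inr i)"
    by (simp add: vcat_def vec_eq_iff split: sum.split)
qed

lemma vcat_eq_0_iff: "x /// y = 0 \<longleftrightarrow> x = 0 \<and> y = 0" for x :: "real^'a::finite"
proof
  assume eq: "x /// y = 0"
  have "x $ i = 0" for i
    using arg_cong[OF eq, of "\<lambda>v. v $ Inl i"] by (simp add: vcat_def)
  moreover have "y $ i = 0" for i
    using arg_cong[OF eq, of "\<lambda>v. v $ Inr i"] by (simp add: vcat_def)
  ultimately show "x = 0 \<and> y = 0" by (simp add: vec_eq_iff)
qed (simp add: vcat_def vec_eq_iff split: sum.split)

lemma mat_mult_vec: "mat k *v x = k *\<^sub>R x" for x :: "real^'a::finite"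
  by (simp add: vec_eq_iff matrix_vector_mult_def mat_def if_distrib if_distribR cong: if_cong)

lemma minus_mult_vec: "(- M) *v x = - (M *v x)" for M :: "real^'a::finite^'b::finite"
  by (simp add: vec_eq_iff matrix_vector_mult_def sum_negf)

lemma transpose_He: "transpose (He M) = He M"
  by (simp add: He_def vec_eq_iff transpose_def)

lemma transpose_add: "transpose (M + N) = transpose M + transpose N"
  by (simp add: vec_eq_iff transpose_def)

lemma inner_matrix_transpose: "x \<bullet> (transpose M *v y) = y \<bullet> (M *v x)"
  for M :: "real^'a::finite^'b::finite"
  by (metis dot_lmul_matrix inner_commute transpose_matrix_vector)

lemma inner_transpose_left: "(transpose M *v x) \<bullet> y = x \<bullet> (M *v y)"
  for M :: "real^'a::finite^'b::finite"
  by (metis inner_matrix_transpose inner_commute)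

lemma inner_symmetric_matrix:
  fixes M :: "real^'a::finite^'a"
  assumes "transpose M = M"
  shows "x \<bullet> (M *v y) = y \<bullet> (M *v x)"
  using inner_matrix_transpose[of x M y] assms by simp

lemma inner_symmetric_transpose:
  fixes M :: "real^'a::finite^'a" and N :: "real^'a^'b::finite"
  assumes "transpose M = M"
  shows "x \<bullet> (M *v (transpose N *v y)) = y \<bullet> (N *v (M *v x))"
  by (metis assms inner_symmetric_matrix inner_transpose_left)

lemma quadratic_form_He_product:
  fixes U V :: "real^'a::finite^'b::finite"
  shows "x \<bullet> (He (transpose U ** G ** V) *v x) = 2 * ((U *v x) \<bullet> (G *v (V *v x)))"
proof -
  have "x \<bullet> ((transpose U ** G ** V) *v x) = (U *v x) \<bullet> (G *v (V *v x))"
    by (simp add: matrix_vector_mul_assoc[symmetric] inner_matrix_transpose inner_commute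
        del: transpose_matrix_vector)
  then show ?thesis
    by (simp add: He_def matrix_vector_mult_add_rdistrib inner_add_right inner_matrix_transpose
        del: transpose_matrix_vector)
qed

section \<open>Small dilations of a negative definite form\<close>

text \<open>A continuous positive function is bounded away from zero on the compact unit sphere;
  homogeneity spreads the bound to all vectors.\<close>

lemma pos_def_coercive:
  fixes M :: "real^'a::finite^'a"
  assumes "pos_def M"
  obtains c where "c > 0" "\<And>x. c * (norm x)\<^sup>2 \<le> x \<bullet> (M *v x)"
proof -
  let ?S = "sphere (0 :: real^'a) 1"
  have "continuous_on ?S (\<lambda>x. x \<bullet> (M *v x))"
    by (intro continuous_intros matrix_vector_mult_linear_continuous_on)
  moreover have "?S \<noteq> {}" by simp
  ultimately have "\<exists>e\<in>?S. \<forall>x\<in>?S. e \<bullet> (M *v e) \<le> x \<bullet> (M *v x)"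
    by (intro continuous_attains_inf compact_sphere)
  then obtain e where e: "e \<in> ?S" "\<And>x. x \<in> ?S \<Longrightarrow> e \<bullet> (M *v e) \<le> x \<bullet> (M *v x)"
    by blast
  show ?thesis
  proof
    have "e \<noteq> 0" using e(1) by auto
    then show "e \<bullet> (M *v e) > 0" using assms by (simp add: pos_def_def)
    fix x
    show "e \<bullet> (M *v e) * (norm x)\<^sup>2 \<le> x \<bullet> (M *v x)"
    proof (cases "x = 0")
      case False
      define y where "y = x /\<^sub>R norm x"
      have x: "x = norm x *\<^sub>R y" using False by (simp add: y_def)
      have "y \<in> ?S" using False by (simp add: y_def)
      then have "(norm x)\<^sup>2 * (e \<bullet> (M *v e)) \<le> (norm x)\<^sup>2 * (y \<bullet> (M *v y))"
        using e(2) by (intro mult_left_mono) auto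
      also have "\<dots> = x \<bullet> (M *v x)"
        by (subst (2 3) x) (simp add: matrix_vector_mult_scaleR power2_eq_square)
      finally show ?thesis by (simp add: mult.commute)
    qed simp
  qed
qed

text \<open>With coercivity constants \<open>c\<close>, \<open>s\<close> of \<open>- M\<close> and \<open>S\<close> and a bound \<open>m\<close> on \<open>N\<close>, the form is
  at most \<open>- (c a\<^sup>2 - 4 \<epsilon> m a b + 4 \<epsilon> s b\<^sup>2)\<close> in the norms \<open>a\<close>, \<open>b\<close> of \<open>h\<close>, \<open>v\<close>. The
  condition for this to be negative definite is \<open>\<epsilon> m\<^sup>2 < c s\<close>.\<close>

lemma small_dilation_negative:
  fixes M :: "real^'a::finite^'a" and S :: "real^'n::finite^'n" and N :: "real^'n^'a"
  assumes "neg_def M" and "pos_def S"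
  obtains \<epsilon> where "\<epsilon> \<in> {0<..<1}"
    "\<And>h v. h \<noteq> 0 \<or> v \<noteq> 0 \<Longrightarrow> h \<bullet> (M *v h) - 4 * \<epsilon> * (h \<bullet> (N *v v) + v \<bullet> (S *v v)) < 0"
proof -
  have "pos_def (- M)"
    using assms(1) by (auto simp: neg_def_def pos_def_def minus_mult_vec transpose_def vec_eq_iff)
  then obtain c where c: "c > 0" "\<And>h. c * (norm h)\<^sup>2 \<le> - (h \<bullet> (M *v h))"
    by (rule pos_def_coercive) (simp add: minus_mult_vec)
  obtain s where s: "s > 0" "\<And>v. s * (norm v)\<^sup>2 \<le> v \<bullet> (S *v v)"
    using pos_def_coercive[OF assms(2)] by metis
  obtain m where m: "m > 0" "\<And>v. norm (N *v v) \<le> norm v * m"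
    using bounded_linear.pos_bounded[OF matrix_vector_mul_bounded_linear[of N]] by metis
  \<comment> \<open>the denominator keeps \<open>\<epsilon>\<close> below 1 as well as below \<open>c s / m\<^sup>2\<close>\<close>
  define \<epsilon> where "\<epsilon> = c * s / (m\<^sup>2 + c * s)"
  have pos: "c * s > 0" "m\<^sup>2 > 0" using c s m by simp_all
  then have \<epsilon>: "\<epsilon> > 0" "\<epsilon> < 1" by (auto simp: \<epsilon>_def field_simps add_pos_pos)
  have small: "\<epsilon> * m\<^sup>2 < c * s"
  proof -
    have "m\<^sup>2 + c * s \<noteq> 0" using pos by linarith
    then have "\<epsilon> * (m\<^sup>2 + c * s) = c * s" by (simp add: \<epsilon>_def)
    moreover have "\<epsilon> * (c * s) > 0" using pos \<epsilon> by simp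
    ultimately show ?thesis by (simp add: distrib_left)
  qed
  show ?thesis
  proof
    show "\<epsilon> \<in> {0<..<1}" using \<epsilon> by simp
    fix h :: "real^'a" and v :: "real^'n"
    assume nz: "h \<noteq> 0 \<or> v \<noteq> 0"
    let ?a = "norm h" and ?b = "norm v"
    have "- (h \<bullet> (N *v v)) \<le> ?a * norm (N *v v)"
      using Cauchy_Schwarz_ineq2[of h "N *v v"] by simp
    also have "\<dots> \<le> ?a * (?b * m)" using m by (intro mult_left_mono) auto
    finally have "- (h \<bullet> (N *v v) + v \<bullet> (S *v v)) \<le> m * ?a * ?b - s * ?b\<^sup>2"
      using s(2)[of v] by (simp add: algebra_simps)
    then have "4 * \<epsilon> * - (h \<bullet> (N *v v) + v \<bullet> (S *v v)) \<le> 4 * \<epsilon> * (m * ?a * ?b - s * ?b\<^sup>2)"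
      using \<epsilon> by (intro mult_left_mono) auto
    then have bound: "h \<bullet> (M *v h) - 4 * \<epsilon> * (h \<bullet> (N *v v) + v \<bullet> (S *v v))
        \<le> - (c * ?a\<^sup>2 - 4 * \<epsilon> * m * ?a * ?b + 4 * \<epsilon> * s * ?b\<^sup>2)"
      using c(2)[of h] by (simp add: algebra_simps)
    \<comment> \<open>multiplied by \<open>c\<close> so that the square is completed without division\<close>
    have "c * (c * ?a\<^sup>2 - 4 * \<epsilon> * m * ?a * ?b + 4 * \<epsilon> * s * ?b\<^sup>2)
        = (c * ?a - 2 * \<epsilon> * m * ?b)\<^sup>2 + 4 * \<epsilon> * (c * s - \<epsilon> * m\<^sup>2) * ?b\<^sup>2"
      by (simp add: power2_eq_square algebra_simps)
    also have "\<dots> > 0"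
    proof (cases "v = 0")
      case True
      then show ?thesis using nz c by simp
    next
      case False
      then have "4 * \<epsilon> * (c * s - \<epsilon> * m\<^sup>2) * ?b\<^sup>2 > 0" using \<epsilon> small by simp
      then show ?thesis by (simp add: add_nonneg_pos)
    qed
    finally show "h \<bullet> (M *v h) - 4 * \<epsilon> * (h \<bullet> (N *v v) + v \<bullet> (S *v v)) < 0"
      using bound c(1) by (simp add: zero_less_mult_iff)
  qed
qed

section \<open>The three dilated inequalities\<close>

lemmas block_form_simps =
  hcat_mult_vec vcat_mult_vec vcat_add inner_vcat mat_mult_vec minus_mult_vec
  matrix_vector_mult_add_rdistrib matrix_vector_mult_diff_rdistrib scaleR_matrix_vector_assoc[symmetric]
  matrix_vector_mul_assoc[symmetric] matrix_vector_mult_scaleR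
  matrix_vector_right_distrib matrix_vector_mult_diff_distrib
  inner_add_left inner_add_right inner_diff_left inner_diff_right

text \<open>Each \<open>N\<close> below is \<open>U\<^sup>T Q\<close> without its last block row, for the factor \<open>U\<close> in
  \<open>He (U\<^sup>T Q V)\<close>. In the first inequality the shift \<open>- I/2\<close> turns \<open>He ((A - I/2) Q)\<close> into
  \<open>A Q + Q A\<^sup>T - Q\<close>, whose last term cancels the Lyapunov block \<open>X1 = Q\<close> in the corner.\<close>

lemma L2_gain_dilation:
  fixes A Q :: "real^'s::finite^'s" and B :: "real^'w::finite^'s"
    and C :: "real^'s^'z::finite" and D :: "real^'w^'z"
  assumes Q: "pos_def Q"
    and neg: "neg_def
      (   (A ** Q + Q ** transpose A ||| B         ||| Q ** transpose C)
      /// (transpose B               ||| - mat \<gamma>  ||| transpose D)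
      /// (C ** Q                    ||| D         ||| - mat \<gamma>))" (is "neg_def ?M")
  obtains \<epsilon> where "\<epsilon> \<in> {0<..<1}"
    "neg_def
      ((  (Q           ||| B        ||| 0           ||| - Q)
      /// (transpose B ||| - mat \<gamma> ||| transpose D ||| 0)
      /// (0           ||| D        ||| - mat \<gamma>    ||| 0)
      /// (- Q         ||| 0        ||| 0           ||| 0))
      + He (transpose (transpose A - mat (1/2) ||| 0 ||| transpose C ||| mat 1)
            ** Q ** (mat 1 ||| 0 ||| 0 ||| - mat (2 * \<epsilon>))))"
proof -
  have sym: "transpose Q = Q" using Q by (simp add: pos_def_def)
  then have symQ: "Q $ i $ j = Q $ j $ i" for i j
    by (metis transpose_def vec_lambda_beta)
  let ?N = "(A ** Q - (1/2) *\<^sub>R Q) /// (0 :: real^'s^'w) /// (C ** Q)"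
  obtain \<epsilon> where \<epsilon>: "\<epsilon> \<in> {0<..<1}" and form:
    "\<And>h v. h \<noteq> 0 \<or> v \<noteq> 0 \<Longrightarrow> h \<bullet> (?M *v h) - 4 * \<epsilon> * (h \<bullet> (?N *v v) + v \<bullet> (Q *v v)) < 0"
    using small_dilation_negative[OF neg Q] by metis
  show ?thesis
  proof (rule that[OF \<epsilon>], unfold neg_def_def, intro conjI allI impI)
    let ?L = "(Q           ||| B        ||| 0           ||| - Q)
      /// (transpose B ||| - mat \<gamma> ||| transpose D ||| 0)
      /// (0           ||| D        ||| - mat \<gamma>    ||| 0)
      /// (- Q         ||| 0        ||| 0           ||| 0)"
    let ?H = "He (transpose (transpose A - mat (1/2) ||| 0 ||| transpose C ||| mat 1)
            ** Q ** (mat 1 ||| 0 ||| 0 ||| - mat (2 * \<epsilon>)))"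
    have "transpose ?L = ?L"
      by (auto simp: vec_eq_iff transpose_def hcat_def vcat_def mat_def symQ split: sum.split)
    then show "transpose (?L + ?H) = ?L + ?H"
      by (simp only: transpose_add transpose_He)
    fix \<xi> :: "real^('s + 'w + 'z + 's)"
    assume "\<xi> \<noteq> 0"
    obtain x w z v where \<xi>: "\<xi> = x /// w /// z /// v" by (metis vcat_exhaust)
    have "\<xi> \<bullet> ((?L + ?H) *v \<xi>) = (x /// w /// z) \<bullet> (?M *v (x /// w /// z))
        - 4 * \<epsilon> * ((x /// w /// z) \<bullet> (?N *v v) + v \<bullet> (Q *v v))"
      unfolding matrix_vector_mult_add_rdistrib[of ?L ?H] inner_add_right
        quadratic_form_He_product \<xi>
      by (simp add: block_form_simps inner_matrix_transpose inner_transpose_left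
          inner_symmetric_transpose[OF sym] inner_symmetric_matrix[OF sym, of v x] algebra_simps
          del: transpose_matrix_vector)
    also have "\<dots> < 0"
      using \<open>\<xi> \<noteq> 0\<close> form[of "x /// w /// z" v] by (auto simp: \<xi> vcat_eq_0_iff)
    finally show "\<xi> \<bullet> ((?L + ?H) *v \<xi>) < 0" .
  qed
qed

text \<open>The same cancellation with the further shift \<open>\<alpha>/2\<close>, which supplies the term \<open>\<alpha> Q\<close>.\<close>

lemma reachable_ellipsoid_dilation:
  fixes A Q :: "real^'s::finite^'s" and B :: "real^'w::finite^'s"
  assumes Q: "pos_def Q"
    and neg: "neg_def
      (   (A ** Q + Q ** transpose A + \<alpha> *\<^sub>R Q ||| B)
      /// (transpose B                           ||| - mat \<alpha>))" (is "neg_def ?M")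
  obtains \<epsilon> where "\<epsilon> \<in> {0<..<1}"
    "neg_def
      ((  (Q           ||| B       ||| - Q)
      /// (transpose B ||| - mat \<alpha> ||| 0)
      /// (- Q         ||| 0       ||| 0))
      + He (transpose (transpose A + mat (\<alpha>/2) - mat (1/2) ||| 0 ||| mat 1)
            ** Q ** (mat 1 ||| 0 ||| - mat (2 * \<epsilon>))))"
proof -
  have sym: "transpose Q = Q" using Q by (simp add: pos_def_def)
  then have symQ: "Q $ i $ j = Q $ j $ i" for i j
    by (metis transpose_def vec_lambda_beta)
  let ?N = "(A ** Q + (\<alpha>/2) *\<^sub>R Q - (1/2) *\<^sub>R Q) /// (0 :: real^'s^'w)"
  obtain \<epsilon> where \<epsilon>: "\<epsilon> \<in> {0<..<1}" and form:
    "\<And>h v. h \<noteq> 0 \<or> v \<noteq> 0 \<Longrightarrow> h \<bullet> (?M *v h) - 4 * \<epsilon> * (h \<bullet> (?N *v v) + v \<bullet> (Q *v v)) < 0"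
    using small_dilation_negative[OF neg Q] by metis
  show ?thesis
  proof (rule that[OF \<epsilon>], unfold neg_def_def, intro conjI allI impI)
    let ?L = "(Q           ||| B       ||| - Q)
      /// (transpose B ||| - mat \<alpha> ||| 0)
      /// (- Q         ||| 0       ||| 0)"
    let ?H = "He (transpose (transpose A + mat (\<alpha>/2) - mat (1/2) ||| 0 ||| mat 1)
            ** Q ** (mat 1 ||| 0 ||| - mat (2 * \<epsilon>)))"
    have "transpose ?L = ?L"
      by (auto simp: vec_eq_iff transpose_def hcat_def vcat_def mat_def symQ split: sum.split)
    then show "transpose (?L + ?H) = ?L + ?H"
      by (simp only: transpose_add transpose_He)
    fix \<xi> :: "real^('s + 'w + 's)"
    assume "\<xi> \<noteq> 0"
    obtain x w v where \<xi>: "\<xi> = x /// w /// v" by (metis vcat_exhaust)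
    have "\<xi> \<bullet> ((?L + ?H) *v \<xi>) = (x /// w) \<bullet> (?M *v (x /// w))
        - 4 * \<epsilon> * ((x /// w) \<bullet> (?N *v v) + v \<bullet> (Q *v v))"
      unfolding matrix_vector_mult_add_rdistrib[of ?L ?H] inner_add_right
        quadratic_form_He_product \<xi>
      by (simp add: block_form_simps inner_matrix_transpose inner_transpose_left
          inner_symmetric_transpose[OF sym] inner_symmetric_matrix[OF sym, of v x] algebra_simps
          del: transpose_matrix_vector)
    also have "\<dots> < 0"
      using \<open>\<xi> \<noteq> 0\<close> form[of "x /// w" v] by (auto simp: \<xi> vcat_eq_0_iff)
    finally show "\<xi> \<bullet> ((?L + ?H) *v \<xi>) < 0" .
  qed
qed

text \<open>No dynamics enter here: the corner is \<open>Q + He (- Q) = - Q\<close>, as in the conventional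
  inequality.\<close>

lemma actuator_limit_dilation:
  fixes Q :: "real^'s::finite^'s" and K :: "real^'s^'u::finite"
  assumes Q: "pos_def Q"
    and neg: "neg_def
      (   (- Q        ||| - (Q ** transpose K))
      /// (- (K ** Q) ||| - mat r))" (is "neg_def ?M")
  obtains \<epsilon> where "\<epsilon> \<in> {0<..<1}"
    "neg_def
      ((  (Q   ||| 0       ||| - Q)
      /// (0   ||| - mat r ||| 0)
      /// (- Q ||| 0       ||| 0))
      + He (transpose (- mat 1 ||| - transpose K ||| mat 1)
            ** Q ** (mat 1 ||| 0 ||| - mat (2 * \<epsilon>))))"
proof -
  have sym: "transpose Q = Q" using Q by (simp add: pos_def_def)
  then have symQ: "Q $ i $ j = Q $ j $ i" for i j
    by (metis transpose_def vec_lambda_beta)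
  let ?N = "- Q /// - (K ** Q)"
  obtain \<epsilon> where \<epsilon>: "\<epsilon> \<in> {0<..<1}" and form:
    "\<And>h v. h \<noteq> 0 \<or> v \<noteq> 0 \<Longrightarrow> h \<bullet> (?M *v h) - 4 * \<epsilon> * (h \<bullet> (?N *v v) + v \<bullet> (Q *v v)) < 0"
    using small_dilation_negative[OF neg Q] by metis
  show ?thesis
  proof (rule that[OF \<epsilon>], unfold neg_def_def, intro conjI allI impI)
    let ?L = "(Q   ||| 0       ||| - Q)
      /// (0   ||| - (mat r :: real^'u^'u) ||| 0)
      /// (- Q ||| 0       ||| 0)"
    let ?H = "He (transpose (- mat 1 ||| - transpose K ||| mat 1)
            ** Q ** (mat 1 ||| 0 ||| - mat (2 * \<epsilon>)))"
    have "transpose ?L = ?L"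
      by (auto simp: vec_eq_iff transpose_def hcat_def vcat_def mat_def symQ split: sum.split)
    then show "transpose (?L + ?H) = ?L + ?H"
      by (simp only: transpose_add transpose_He)
    fix \<xi> :: "real^('s + 'u + 's)"
    assume "\<xi> \<noteq> 0"
    obtain x u v where \<xi>: "\<xi> = x /// u /// v" by (metis vcat_exhaust)
    have "\<xi> \<bullet> ((?L + ?H) *v \<xi>) = (x /// u) \<bullet> (?M *v (x /// u))
        - 4 * \<epsilon> * ((x /// u) \<bullet> (?N *v v) + v \<bullet> (Q *v v))"
      unfolding matrix_vector_mult_add_rdistrib[of ?L ?H] inner_add_right
        quadratic_form_He_product \<xi>
      by (simp add: block_form_simps inner_matrix_transpose inner_transpose_left
          inner_symmetric_transpose[OF sym] inner_symmetric_matrix[OF sym, of v x] algebra_simps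
          del: transpose_matrix_vector)
    also have "\<dots> < 0"
      using \<open>\<xi> \<noteq> 0\<close> form[of "x /// u" v] by (auto simp: \<xi> vcat_eq_0_iff)
    finally show "\<xi> \<bullet> ((?L + ?H) *v \<xi>) < 0" .
  qed
qed

section \<open>Comparison of the optimal values\<close>

lemma feasible_con_imp_feasible_new:
  assumes "feasible_con ulim wmax L \<gamma> Q \<alpha>"
  shows "\<exists>\<epsilon>1 \<epsilon>2 \<epsilon>3. feasible_new ulim wmax L \<gamma> Q Q Q \<alpha> \<epsilon>1 \<epsilon>2 \<epsilon>3"
proof -
  note con = assms[unfolded feasible_con_def]
  have Q: "pos_def Q" using con by simp
  note gain = con[THEN conjunct2, THEN conjunct2, THEN conjunct1]
    and reach = con[THEN conjunct2, THEN conjunct2, THEN conjunct2, THEN conjunct1]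
    and limit = con[THEN conjunct2, THEN conjunct2, THEN conjunct2, THEN conjunct2]
  show ?thesis
    unfolding feasible_new_def
    by (rule L2_gain_dilation[OF Q gain], rule reachable_ellipsoid_dilation[OF Q reach],
        rule actuator_limit_dilation[OF Q limit]) (use con in blast)
qed

lemma gamma_new_le_gamma_con: "gamma_new ulim wmax loop \<le> gamma_con ulim wmax loop"
  unfolding gamma_new_def gamma_con_def
proof (rule Inf_superset_mono, rule subsetI)
  fix g
  assume "g \<in> {ereal \<gamma> | \<gamma>. \<exists>c Q \<alpha>. feasible_con ulim wmax (loop c) \<gamma> Q \<alpha>}"
  then obtain \<gamma> c Q \<alpha> where g: "g = ereal \<gamma>" and con: "feasible_con ulim wmax (loop c) \<gamma> Q \<alpha>"
    by blast
  show "g \<in> {ereal \<gamma> | \<gamma>. \<exists>c X1 X2 G \<alpha> \<epsilon>1 \<epsilon>2 \<epsilon>3.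
      feasible_new ulim wmax (loop c) \<gamma> X1 X2 G \<alpha> \<epsilon>1 \<epsilon>2 \<epsilon>3}"
    using g feasible_con_imp_feasible_new[OF con] by blast
qed

theorem theorem4:
  fixes P :: "('n::finite, 'w::finite, 'u::finite, 'z::finite, 'y::finite) plant"
    and ulim wmax :: real
  assumes "ulim > 0" and "wmax > 0"
  shows "gamma_new ulim wmax (state_feedback_loop P) \<le> gamma_con ulim wmax (state_feedback_loop P) \<and>
         gamma_new ulim wmax (output_feedback_loop P) \<le> gamma_con ulim wmax (output_feedback_loop P)"
  by (simp add: gamma_new_le_gamma_con)

end
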